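(* Let $M_0,M_1,\ldots$ be a sequence of nested models containing numbers of parameters $m_0<m_1<\cdots$, respectively. Assume that under $H_0$ (the hypothesis that the null model $M_0$ is true) and as $n\to\infty$, $$\mathcal{L}_1\xrightarrow{\mathcal{D}}\chi^2_{m_1-m_0}.$$ Furthermore, assume that, as $n\to\infty$, $\mathcal{L}_j$ is bounded in probability for each $j=2,3,\ldots$. Then there exists a sequence $\{K_n\}$ tending to infinity such that $$n^{(m_1-m_0)/2}\left[1-\left(1+\sum_{j=1}^{K_n}\exp(\mathrm{BIC}_j-\mathrm{BIC}_0)\right)^{-1}\right]\xrightarrow{\mathcal{D}}\exp\left(\tfrac12\chi^2_{m_1-m_0}\right)$$ as $n\to\infty$.
   Context: The observed data vector has dimension (sample size) $n$. $L_j$ denotes the likelihood function of model $M_j$ evaluated at its maximum likelihood estimate, $\mathcal{L}_j=2\log(L_j/L_0)$, and $\mathrm{BIC}_j=\log L_j-\frac12 m_j\log n$. Nested means that $M_j$ is a special case of $M_{j+1}$ for $j=0,1,\ldots$. All probability statements are under $H_0$. $\chi^2_k$ denotes a random variable having the chi-squared distribution with $k$ degrees of freedom; $\xrightarrow{\mathcal{D}}$ denotes convergence in distribution. *)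

theory Defs
  imports "HOL-Probability.Probability"
begin

text \<open>A vector in \<open>\<real>\<^sup>n\<close> is an extensional function on \<open>{..<n}\<close>.\<close>

definition data_space :: "nat \<Rightarrow> (nat \<Rightarrow> real) measure" where
  "data_space n = (\<Pi>\<^sub>M i\<in>{..<n}. borel)"

text \<open>
  \<open>dens M n \<theta> y\<close> is the density at \<open>y\<close>, under the parameter \<open>\<theta>\<close> and at sample size \<open>n\<close>, with respect
  to a reference measure \<open>\<nu> n\<close> that is shared by all models (Lebesgue or counting measure, for
  instance). As a function of \<open>\<theta>\<close> it is the likelihood function. The components of the data vector
  need not be independent.
\<close>

record model =
  nparams :: nat
  params :: "(nat \<Rightarrow> real) set"
  dens :: "nat \<Rightarrow> (nat \<Rightarrow> real) \<Rightarrow> (nat \<Rightarrow> real) \<Rightarrow> real"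

definition data_distr ::
  "(nat \<Rightarrow> (nat \<Rightarrow> real) measure) \<Rightarrow> model \<Rightarrow> (nat \<Rightarrow> real) \<Rightarrow> nat \<Rightarrow> (nat \<Rightarrow> real) measure" where
  "data_distr \<nu> M \<theta> n = density (\<nu> n) (\<lambda>y. ennreal (dens M n \<theta> y))"

definition statistical_model :: "(nat \<Rightarrow> (nat \<Rightarrow> real) measure) \<Rightarrow> model \<Rightarrow> bool" where
  "statistical_model \<nu> M \<longleftrightarrow>
     params M \<noteq> {} \<and> params M \<subseteq> ({..<nparams M} \<rightarrow>\<^sub>E UNIV) \<and>
     (\<forall>n\<ge>1. \<forall>\<theta>\<in>params M.
        dens M n \<theta> \<in> borel_measurable (data_space n) \<and>
        (\<forall>y\<in>space (data_space n). 0 \<le> dens M n \<theta> y) \<and>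
        prob_space (data_distr \<nu> M \<theta> n))"

definition nested :: "model \<Rightarrow> model \<Rightarrow> bool" where
  "nested M M' \<longleftrightarrow>
     (\<forall>n\<ge>1. \<forall>\<theta>\<in>params M. \<exists>\<theta>'\<in>params M'.
        \<forall>y\<in>space (data_space n). dens M n \<theta> y = dens M' n \<theta>' y)"

definition is_mle :: "model \<Rightarrow> nat \<Rightarrow> (nat \<Rightarrow> real) \<Rightarrow> (nat \<Rightarrow> real) \<Rightarrow> bool" where
  "is_mle M n y \<theta> \<longleftrightarrow> \<theta> \<in> params M \<and> (\<forall>\<theta>'\<in>params M. dens M n \<theta>' y \<le> dens M n \<theta> y)"

text \<open>An estimator \<open>est\<close> maps the sample size and the data to a parameter vector.\<close>

definition max_lik ::
  "model \<Rightarrow> (nat \<Rightarrow> (nat \<Rightarrow> real) \<Rightarrow> (nat \<Rightarrow> real)) \<Rightarrow> nat \<Rightarrow> (nat \<Rightarrow> real) \<Rightarrow> real" where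
  "max_lik M est n y = dens M n (est n y) y"

definition log_lik_ratio ::
  "(nat \<Rightarrow> model) \<Rightarrow> (nat \<Rightarrow> nat \<Rightarrow> (nat \<Rightarrow> real) \<Rightarrow> (nat \<Rightarrow> real)) \<Rightarrow> nat \<Rightarrow> nat \<Rightarrow> (nat \<Rightarrow> real) \<Rightarrow> real"
  where
  "log_lik_ratio M est j n y = 2 * ln (max_lik (M j) (est j) n y / max_lik (M 0) (est 0) n y)"

definition BIC ::
  "model \<Rightarrow> (nat \<Rightarrow> (nat \<Rightarrow> real) \<Rightarrow> (nat \<Rightarrow> real)) \<Rightarrow> nat \<Rightarrow> (nat \<Rightarrow> real) \<Rightarrow> real" where
  "BIC M est n y = ln (max_lik M est n y) - 1 / 2 * real (nparams M) * ln (real n)"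

text \<open>
  The random variables live on a probability space that varies with \<open>n\<close>. Measurability is part of the
  definition because \<^const>\<open>distr\<close> is meaningless for non-measurable maps.
\<close>

definition converges_in_distribution ::
  "(nat \<Rightarrow> 'a measure) \<Rightarrow> (nat \<Rightarrow> 'a \<Rightarrow> real) \<Rightarrow> real measure \<Rightarrow> bool" where
  "converges_in_distribution P X \<mu> \<longleftrightarrow>
     (\<forall>\<^sub>F n in sequentially. X n \<in> borel_measurable (P n)) \<and>
     weak_conv_m (\<lambda>n. distr (P n) borel (X n)) \<mu>"

definition bounded_in_probability ::
  "(nat \<Rightarrow> 'a measure) \<Rightarrow> (nat \<Rightarrow> 'a \<Rightarrow> real) \<Rightarrow> bool" where
  "bounded_in_probability P X \<longleftrightarrow>
     (\<forall>\<epsilon>>0. \<exists>C. \<forall>\<^sub>F n in sequentially. measure (P n) {y \<in> space (P n). \<bar>X n y\<bar> > C} < \<epsilon>)"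

text \<open>The law of the sum of squares of \<open>k\<close> independent standard normal variables.\<close>

definition chi_squared :: "nat \<Rightarrow> real measure" where
  "chi_squared k =
     distr (\<Pi>\<^sub>M i\<in>{..<k}. density lborel std_normal_density) borel (\<lambda>z. \<Sum>i<k. (z i)\<^sup>2)"

end

theory Submission
  imports Defs
begin

text \<open>
  Write \<open>q\<^sub>j = exp (L\<^sub>j / 2)\<close> for the likelihood ratios, so that
  \<open>exp (BIC\<^sub>j - BIC\<^sub>0) = q\<^sub>j n powr (- (m\<^sub>j - m\<^sub>0) / 2)\<close>. For a fixed number \<open>k\<close> of models
  all \<open>q\<^sub>j\<close> with \<open>1 \<le> j \<le> k\<close> are at most some constant outside an event of small probability, and
  there the statistic differs from \<open>q\<^sub>1\<close> by a deterministic sequence tending to \<open>0\<close>. Hence the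
  difference tends to \<open>0\<close> in probability for each \<open>k\<close>, a diagonal argument gives the same for some
  \<open>K\<^sub>n\<close> tending to infinity slowly enough, and \<open>q\<^sub>1\<close> has the required limit law by continuous mapping.
\<close>

section \<open>Convergence in distribution\<close>

lemma weak_conv_m_cong:
  assumes "\<forall>\<^sub>F n in sequentially. M n = N n"
  shows "weak_conv_m M \<mu> \<longleftrightarrow> weak_conv_m N \<mu>"
proof -
  have "\<forall>\<^sub>F n in sequentially. cdf (M n) x = cdf (N n) x" for x
    using assms by eventually_elim simp
  then have "((\<lambda>n. cdf (M n) x) \<longlonglongrightarrow> l) \<longleftrightarrow> ((\<lambda>n. cdf (N n) x) \<longlonglongrightarrow> l)" for x l
    by (rule tendsto_cong)
  then show ?thesis
    unfolding weak_conv_m_def weak_conv_def by simp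
qed

lemma isCont_cts_step: "a < b \<Longrightarrow> isCont (cts_step a b) x"
  using uniformly_continuous_imp_continuous[OF cts_step_uniformly_continuous, of a b]
  by (simp add: continuous_on_eq_continuous_at)

lemma cts_step_bounds: "0 \<le> cts_step a b x" "cts_step a b x \<le> 1"
  by (auto simp: cts_step_def field_simps)

lemma borel_measurable_cts_step [measurable]: "cts_step a b \<in> borel_measurable borel"
  unfolding cts_step_def[abs_def] by measurable

text \<open>The library results on weak convergence ask for real distributions at every index.\<close>

definition regular_distr :: "'a measure \<Rightarrow> ('a \<Rightarrow> real) \<Rightarrow> real measure \<Rightarrow> real measure" where
  "regular_distr P X \<mu> =
     (if prob_space P \<and> X \<in> borel_measurable P then distr P borel X else \<mu>)"

lemma real_distribution_regular_distr:
  "real_distribution \<mu> \<Longrightarrow> real_distribution (regular_distr P X \<mu>)"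
  by (auto simp: regular_distr_def prob_space.real_distribution_distr)

text \<open>One direction of the portmanteau theorem, pulled back by change of variables from the
  laws on the line to the spaces \<open>P n\<close>.\<close>

lemma converges_in_distribution_integral:
  fixes g :: "real \<Rightarrow> real"
  assumes P: "\<forall>\<^sub>F n in sequentially. prob_space (P n)"
    and X: "converges_in_distribution P X \<mu>"
    and \<mu>: "real_distribution \<mu>"
    and g: "\<And>x. isCont g x" and B: "\<And>x. \<bar>g x\<bar> \<le> B"
  shows "(\<lambda>n. \<integral>y. g (X n y) \<partial>P n) \<longlonglongrightarrow> (\<integral>x. g x \<partial>\<mu>)"
proof -
  have [measurable]: "g \<in> borel_measurable borel"
    using g by (intro borel_measurable_continuous_onI) (simp add: continuous_on_eq_continuous_at)
  have m: "\<forall>\<^sub>F n in sequentially. X n \<in> borel_measurable (P n)"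
    using X by (simp add: converges_in_distribution_def)
  \<comment> \<open>The default value \<open>\<mu>\<close> occurs only at indices where
    \<open>P n\<close> or \<open>X n\<close> is not yet well behaved, so the limit is
    unaffected.\<close>
  have "\<forall>\<^sub>F n in sequentially. regular_distr (P n) (X n) \<mu> = distr (P n) borel (X n)"
    using P m by eventually_elim (simp add: regular_distr_def)
  then have "weak_conv_m (\<lambda>n. regular_distr (P n) (X n) \<mu>) \<mu>"
    using X weak_conv_m_cong[of "\<lambda>n. regular_distr (P n) (X n) \<mu>"]
    by (simp add: converges_in_distribution_def)
  then have "(\<lambda>n. \<integral>x. g x \<partial>regular_distr (P n) (X n) \<mu>) \<longlonglongrightarrow> (\<integral>x. g x \<partial>\<mu>)"
    using g B \<mu> by (intro weak_conv_imp_integral_bdd_continuous_conv)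
      (auto simp: real_distribution_regular_distr)
  moreover have "\<forall>\<^sub>F n in sequentially.
      (\<integral>x. g x \<partial>regular_distr (P n) (X n) \<mu>) = (\<integral>y. g (X n y) \<partial>P n)"
    using P m by eventually_elim (simp add: regular_distr_def integral_distr)
  ultimately show ?thesis
    by (rule Lim_transform_eventually)
qed

text \<open>The function \<open>cts_step a b\<close> lies between the indicators of
  \<open>{..a}\<close> and \<open>{..b}\<close>, so its integrals pin down the cdf at continuity
  points of the limit.\<close>

lemma converges_in_distributionI_cts_step:
  assumes P: "\<forall>\<^sub>F n in sequentially. prob_space (P n)"
    and m: "\<forall>\<^sub>F n in sequentially. X n \<in> borel_measurable (P n)"
    and \<mu>: "real_distribution \<mu>"
    and lim: "\<And>a b. a < b \<Longrightarrow>
      (\<lambda>n. \<integral>y. cts_step a b (X n y) \<partial>P n) \<longlonglongrightarrow> (\<integral>x. cts_step a b x \<partial>\<mu>)"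
  shows "converges_in_distribution P X \<mu>"
proof -
  have ev: "\<forall>\<^sub>F n in sequentially. regular_distr (P n) (X n) \<mu> = distr (P n) borel (X n)"
    using P m by eventually_elim (simp add: regular_distr_def)
  have "weak_conv_m (\<lambda>n. regular_distr (P n) (X n) \<mu>) \<mu>"
  proof (rule integral_cts_step_conv_imp_weak_conv)
    fix a b :: real assume "a < b"
    have "\<forall>\<^sub>F n in sequentially. (\<integral>y. cts_step a b (X n y) \<partial>P n) =
        (\<integral>x. cts_step a b x \<partial>regular_distr (P n) (X n) \<mu>)"
      using P m by eventually_elim (simp add: regular_distr_def integral_distr)
    then show "(\<lambda>n. \<integral>x. cts_step a b x \<partial>regular_distr (P n) (X n) \<mu>)
        \<longlonglongrightarrow> (\<integral>x. cts_step a b x \<partial>\<mu>)"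
      by (rule Lim_transform_eventually[OF lim[OF \<open>a < b\<close>]])
  qed (use \<mu> in \<open>auto simp: real_distribution_regular_distr\<close>)
  then show ?thesis
    using m weak_conv_m_cong[OF ev] by (simp add: converges_in_distribution_def)
qed

text \<open>A step function composed with \<open>f\<close> is again a bounded continuous test
  function, even for unbounded \<open>f\<close> such as the exponential.\<close>

lemma converges_in_distribution_continuous_map:
  assumes P: "\<forall>\<^sub>F n in sequentially. prob_space (P n)"
    and X: "converges_in_distribution P X \<mu>"
    and \<mu>: "real_distribution \<mu>"
    and f: "\<And>x. isCont f x"
  shows "converges_in_distribution P (\<lambda>n y. f (X n y)) (distr \<mu> borel f)"
proof (rule converges_in_distributionI_cts_step[OF P])
  interpret real_distribution \<mu> by (rule \<mu>)
  have [measurable]: "f \<in> borel_measurable borel"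
    using f by (intro borel_measurable_continuous_onI) (simp add: continuous_on_eq_continuous_at)
  show "\<forall>\<^sub>F n in sequentially. (\<lambda>y. f (X n y)) \<in> borel_measurable (P n)"
    using X unfolding converges_in_distribution_def by (auto elim!: eventually_mono)
  show "real_distribution (distr \<mu> borel f)"
    by simp
  fix a b :: real assume "a < b"
  have "(\<lambda>n. \<integral>y. cts_step a b (f (X n y)) \<partial>P n) \<longlonglongrightarrow> (\<integral>x. cts_step a b (f x) \<partial>\<mu>)"
    using cts_step_bounds[of a b] isCont_o2[OF f isCont_cts_step[OF \<open>a < b\<close>]]
    by (intro converges_in_distribution_integral[OF P X \<mu>, where B = 1]) auto
  then show "(\<lambda>n. \<integral>y. cts_step a b (f (X n y)) \<partial>P n)
      \<longlonglongrightarrow> (\<integral>x. cts_step a b x \<partial>distr \<mu> borel f)"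
    by (simp add: integral_distr)
qed

text \<open>A Slutsky argument. Step functions are uniformly continuous with values in [0, 1], so
  the two integrals differ by at most a small oscillation plus the probability that
  \<open>X n\<close> and \<open>Y n\<close> are far apart.\<close>

lemma converges_in_distribution_close:
  assumes P: "\<forall>\<^sub>F n in sequentially. prob_space (P n)"
    and X: "converges_in_distribution P X \<mu>"
    and \<mu>: "real_distribution \<mu>"
    and mY: "\<forall>\<^sub>F n in sequentially. Y n \<in> borel_measurable (P n)"
    and close: "\<And>\<epsilon>. \<epsilon> > 0 \<Longrightarrow> \<forall>\<^sub>F n in sequentially.
      measure (P n) {y \<in> space (P n). \<bar>Y n y - X n y\<bar> > \<epsilon>} < \<epsilon>"
  shows "converges_in_distribution P Y \<mu>"
proof (rule converges_in_distributionI_cts_step[OF P mY \<mu>])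
  fix a b :: real assume ab: "a < b"
  let ?h = "cts_step a b"
  have mX: "\<forall>\<^sub>F n in sequentially. X n \<in> borel_measurable (P n)"
    using X by (simp add: converges_in_distribution_def)
  have "(\<lambda>n. \<integral>y. ?h (X n y) \<partial>P n) \<longlonglongrightarrow> (\<integral>x. ?h x \<partial>\<mu>)"
    using cts_step_bounds[of a b] isCont_cts_step[OF ab]
    by (intro converges_in_distribution_integral[OF P X \<mu>, where B = 1]) auto
  moreover have "(\<lambda>n. (\<integral>y. ?h (Y n y) \<partial>P n) - (\<integral>y. ?h (X n y) \<partial>P n)) \<longlonglongrightarrow> 0"
  proof (rule tendstoI)
    fix e :: real assume "e > 0"
    then obtain d where d: "d > 0" "\<And>x x'. dist x' x < d \<Longrightarrow> dist (?h x') (?h x) < e / 2"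
      using cts_step_uniformly_continuous[OF ab]
      unfolding uniformly_continuous_on_def by (metis UNIV_I half_gt_zero)
    \<comment> \<open>One number bounds both the deviation and its probability in
      \<open>close\<close>. Half of \<open>d\<close> keeps the distance strictly below the modulus;
      \<open>e / 2\<close> is the share left for the exceptional event.\<close>
    define \<delta> where "\<delta> = min (d / 2) (e / 2)"
    have "\<delta> > 0" using d \<open>e > 0\<close> by (simp add: \<delta>_def)
    show "\<forall>\<^sub>F n in sequentially.
        dist ((\<integral>y. ?h (Y n y) \<partial>P n) - (\<integral>y. ?h (X n y) \<partial>P n)) 0 < e"
      using P mX mY close[OF \<open>\<delta> > 0\<close>]
    proof eventually_elim
      case (elim n)
      interpret prob_space "P n" by (rule elim)
      note [measurable] = elim(2,3)
      let ?A = "{y \<in> space (P n). \<bar>Y n y - X n y\<bar> > \<delta>}"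
      have iY: "integrable (P n) (\<lambda>y. ?h (Y n y))" and iX: "integrable (P n) (\<lambda>y. ?h (X n y))"
        by (auto intro!: integrable_const_bound[where B = 1] simp: cts_step_bounds)
      have iA: "integrable (P n) (\<lambda>y. e / 2 + indicator ?A y)"
        by (intro Bochner_Integration.integrable_add integrable_real_indicator)
          (auto simp: emeasure_eq_measure)
      have "\<bar>?h (Y n y) - ?h (X n y)\<bar> \<le> e / 2 + indicator ?A y" if "y \<in> space (P n)" for y
      proof (cases "y \<in> ?A")
        case True
        then show ?thesis
          using cts_step_bounds[of a b "Y n y"] cts_step_bounds[of a b "X n y"] \<open>e > 0\<close>
          by (simp add: abs_le_iff)
      next
        case False
        then have "dist (Y n y) (X n y) < d"
          using that d(1) by (auto simp: dist_real_def \<delta>_def)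
        from d(2)[OF this] show ?thesis
          using False by (simp add: dist_real_def)
      qed
      then have "\<bar>\<integral>y. ?h (Y n y) - ?h (X n y) \<partial>P n\<bar> \<le> (\<integral>y. e / 2 + indicator ?A y \<partial>P n)"
        using iX iY iA
        by (intro order_trans[OF integral_abs_bound] integral_mono integrable_abs
            Bochner_Integration.integrable_diff) auto
      also have "\<dots> = e / 2 + measure (P n) ?A"
        by (subst Bochner_Integration.integral_add)
          (auto simp: prob_space emeasure_eq_measure)
      also have "\<dots> < e"
        using elim(4) by (simp add: \<delta>_def)
      finally show ?case
        using iX iY by simp
    qed
  qed
  ultimately show "(\<lambda>n. \<integral>y. ?h (Y n y) \<partial>P n) \<longlonglongrightarrow> (\<integral>x. ?h x \<partial>\<mu>)"
    using tendsto_add by fastforce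
qed

section \<open>Boundedness in probability\<close>

text \<open>A single law is tight: a wide enough cutoff has integral above 1 - \<epsilon> under
  \<open>\<mu>\<close>, and convergence of this integral carries the bound over to
  \<open>X n\<close>.\<close>

lemma converges_in_distribution_imp_bounded:
  assumes P: "\<forall>\<^sub>F n in sequentially. prob_space (P n)"
    and X: "converges_in_distribution P X \<mu>"
    and \<mu>: "real_distribution \<mu>"
  shows "bounded_in_probability P X"
  unfolding bounded_in_probability_def
proof (intro allI impI)
  fix \<epsilon> :: real assume "\<epsilon> > 0"
  interpret real_distribution \<mu> by (rule \<mu>)
  have mX: "\<forall>\<^sub>F n in sequentially. X n \<in> borel_measurable (P n)"
    using X by (simp add: converges_in_distribution_def)
  \<comment> \<open>A continuous cutoff: 1 for \<open>\<bar>x\<bar> \<le> m\<close> and 0 for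
    \<open>\<bar>x\<bar> \<ge> m + 1\<close>. It tends to 1 pointwise as \<open>m\<close>
    grows.\<close>
  define g :: "nat \<Rightarrow> real \<Rightarrow> real" where "g m x = cts_step (real m) (real m + 1) \<bar>x\<bar>" for m x
  have [measurable]: "g m \<in> borel_measurable borel" for m
    unfolding g_def[abs_def] by measurable
  have g: "0 \<le> g m x" "g m x \<le> 1" for m x
    by (simp_all add: g_def cts_step_bounds)
  have "isCont (g m) x" for m x
    unfolding g_def[abs_def]
    using isCont_o2[where f = "\<lambda>x::real. \<bar>x\<bar>", OF _ isCont_cts_step[of "real m" "real m + 1"]]
    by simp
  then have conv: "(\<lambda>n. \<integral>y. g m (X n y) \<partial>P n) \<longlonglongrightarrow> (\<integral>x. g m x \<partial>\<mu>)" for m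
    using g by (intro converges_in_distribution_integral[OF P X \<mu>, where B = 1]) auto
  have "(\<lambda>m. \<integral>x. g m x \<partial>\<mu>) \<longlonglongrightarrow> (\<integral>x. 1 \<partial>\<mu>)"
  proof (rule integral_dominated_convergence[where w = "\<lambda>_. 1"])
    show "AE x in \<mu>. (\<lambda>m. g m x) \<longlonglongrightarrow> 1"
    proof (rule AE_I2)
      fix x :: real
      have "\<forall>\<^sub>F m in sequentially. g m x = 1"
        using eventually_ge_at_top[of "nat \<lceil>\<bar>x\<bar>\<rceil>"]
        by eventually_elim (auto simp: g_def cts_step_def nat_le_iff ceiling_le_iff)
      then show "(\<lambda>m. g m x) \<longlonglongrightarrow> 1"
        by (rule tendsto_eventually)
    qed
  qed (use g in auto)
  then have "\<forall>\<^sub>F m in sequentially. (\<integral>x. g m x \<partial>\<mu>) > 1 - \<epsilon>"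
    using \<open>\<epsilon> > 0\<close> by (intro order_tendstoD) (auto simp: prob_space[simplified])
  then obtain m where "(\<integral>x. g m x \<partial>\<mu>) > 1 - \<epsilon>"
    using eventually_happens'[OF sequentially_bot] by blast
  with conv[of m] have "\<forall>\<^sub>F n in sequentially. (\<integral>y. g m (X n y) \<partial>P n) > 1 - \<epsilon>"
    by (rule order_tendstoD)
  with P mX have "\<forall>\<^sub>F n in sequentially.
      measure (P n) {y \<in> space (P n). \<bar>X n y\<bar> > real m + 1} < \<epsilon>"
  proof eventually_elim
    case (elim n)
    interpret P: prob_space "P n" by (rule elim)
    note [measurable] = elim(2)
    let ?A = "{y \<in> space (P n). \<bar>X n y\<bar> > real m + 1}"
    \<comment> \<open>The cutoff vanishes on \<open>?A\<close>, so its integral is at most the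
      probability of the complement.\<close>
    have "(\<integral>y. g m (X n y) \<partial>P n) \<le> (\<integral>y. 1 - indicator ?A y \<partial>P n)"
    proof (rule integral_mono)
      show "integrable (P n) (\<lambda>y. g m (X n y))"
        using g by (intro P.integrable_const_bound[where B = 1]) auto
      show "integrable (P n) (\<lambda>y. 1 - indicator ?A y :: real)"
        by (intro Bochner_Integration.integrable_diff integrable_real_indicator)
          (auto simp: P.emeasure_eq_measure)
      show "g m (X n y) \<le> 1 - indicator ?A y" if "y \<in> space (P n)" for y
        using g by (auto simp: g_def cts_step_def split: split_indicator)
    qed
    also have "\<dots> = 1 - measure (P n) ?A"
      by (subst Bochner_Integration.integral_diff)
        (auto simp: P.prob_space P.emeasure_eq_measure)
    finally show ?case
      using elim(3) by simp
  qed
  then show "\<exists>C. \<forall>\<^sub>F n in sequentially.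
      measure (P n) {y \<in> space (P n). \<bar>X n y\<bar> > C} < \<epsilon>" ..
qed

text \<open>Union bound by induction: half of \<epsilon> goes to the new index and half to the rest,
  hence the generalization over \<epsilon>. The larger of the two constants serves for both.\<close>

lemma bounded_in_probability_finite_family:
  assumes P: "\<forall>\<^sub>F n in sequentially. prob_space (P n)"
    and J: "finite J"
    and m: "\<And>j. j \<in> J \<Longrightarrow> \<forall>\<^sub>F n in sequentially. X j n \<in> borel_measurable (P n)"
    and bd: "\<And>j. j \<in> J \<Longrightarrow> bounded_in_probability P (X j)"
    and "\<epsilon> > 0"
  shows "\<exists>C. \<forall>\<^sub>F n in sequentially.
    measure (P n) {y \<in> space (P n). \<exists>j\<in>J. \<bar>X j n y\<bar> > C} < \<epsilon>"
  using J m bd \<open>\<epsilon> > 0\<close>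
proof (induction J arbitrary: \<epsilon> rule: finite_induct)
  case empty
  then show ?case by simp
next
  case (insert i J)
  obtain C where C: "\<forall>\<^sub>F n in sequentially.
      measure (P n) {y \<in> space (P n). \<exists>j\<in>J. \<bar>X j n y\<bar> > C} < \<epsilon> / 2"
    using insert.IH[of "\<epsilon> / 2"] insert.prems by auto
  obtain D where D: "\<forall>\<^sub>F n in sequentially.
      measure (P n) {y \<in> space (P n). \<bar>X i n y\<bar> > D} < \<epsilon> / 2"
    using insert.prems(2)[of i] insert.prems(3)
    unfolding bounded_in_probability_def by (meson half_gt_zero insertI1)
  have "\<forall>\<^sub>F n in sequentially. \<forall>j\<in>insert i J. X j n \<in> borel_measurable (P n)"
    using insert.prems(1) insert.hyps by (subst eventually_ball_finite_distrib) auto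
  with C D P have "\<forall>\<^sub>F n in sequentially. measure (P n)
      {y \<in> space (P n). \<exists>j\<in>insert i J. \<bar>X j n y\<bar> > max C D} < \<epsilon>"
  proof eventually_elim
    case (elim n)
    interpret prob_space "P n" by (rule elim)
    have [measurable]: "X i n \<in> borel_measurable (P n)"
      using elim by simp
    let ?A = "{y \<in> space (P n). \<exists>j\<in>J. \<bar>X j n y\<bar> > C}"
    let ?B = "{y \<in> space (P n). \<bar>X i n y\<bar> > D}"
    have A: "?A \<in> sets (P n)"
    proof (rule sets.sets_Collect_finite_Ex)
      fix j assume "j \<in> J"
      then have [measurable]: "X j n \<in> borel_measurable (P n)"
        using elim by simp
      show "{y \<in> space (P n). \<bar>X j n y\<bar> > C} \<in> sets (P n)"
        by measurable
    qed (rule insert.hyps)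
    have "measure (P n) {y \<in> space (P n). \<exists>j\<in>insert i J. \<bar>X j n y\<bar> > max C D}
        \<le> measure (P n) (?A \<union> ?B)"
      using A by (intro finite_measure_mono) auto
    also have "\<dots> \<le> measure (P n) ?A + measure (P n) ?B"
      using A by (intro measure_Un_le) auto
    finally show ?case
      using elim by simp
  qed
  then show ?case ..
qed

section \<open>Diagonal choice of the number of models, and the chi-squared law\<close>

text \<open>Let \<open>K n\<close> be the largest \<open>k \<le> n\<close> whose threshold
  \<open>N k\<close> has been passed; it grows slowly enough for \<open>Q\<close> to hold along
  it.\<close>

lemma eventually_diagonal:
  fixes Q :: "nat \<Rightarrow> nat \<Rightarrow> bool"
  assumes "\<And>k. \<forall>\<^sub>F n in sequentially. Q k n"
  obtains K where "filterlim K at_top sequentially" "\<forall>\<^sub>F n in sequentially. Q (K n) n"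
proof -
  obtain N where N: "\<And>k n. n \<ge> N k \<Longrightarrow> Q k n"
    using assms unfolding eventually_sequentially by metis
  \<comment> \<open>The cap \<open>k \<le> n\<close> makes the set finite, so that its maximum
    exists. Every \<open>k\<close> belongs to it once \<open>n\<close> reaches
    \<open>max k (N k)\<close>, which drives the maximum to infinity.\<close>
  define S where "S n = {k. k \<le> n \<and> N k \<le> n}" for n
  have fin: "finite (S n)" for n
    by (rule finite_subset[of _ "{..n}"]) (auto simp: S_def)
  show ?thesis
  proof
    show "filterlim (\<lambda>n. Max (S n)) at_top sequentially"
      unfolding filterlim_at_top
    proof
      fix k
      show "\<forall>\<^sub>F n in sequentially. k \<le> Max (S n)"
        using eventually_ge_at_top[of "max k (N k)"]
        by eventually_elim (auto simp: S_def intro!: Max_ge[OF fin, unfolded S_def])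
    qed
    show "\<forall>\<^sub>F n in sequentially. Q (Max (S n)) n"
      \<comment> \<open>From here on 0 is a member, so the maximum is taken over a nonempty
        set.\<close>
      using eventually_ge_at_top[of "N 0"]
    proof eventually_elim
      case (elim n)
      then have "S n \<noteq> {}" by (auto simp: S_def)
      then have "Max (S n) \<in> S n" using fin by (rule Max_in[rotated])
      then show ?case using N by (simp add: S_def)
    qed
  qed
qed

lemma real_distribution_chi_squared: "real_distribution (chi_squared k)"
proof -
  interpret product_prob_space "\<lambda>_. density lborel std_normal_density" "{..<k}"
    by (intro product_prob_spaceI prob_space_normal_density) simp
  interpret prob_space "\<Pi>\<^sub>M i\<in>{..<k}. density lborel std_normal_density"
    by (rule prob_space_axioms)
  show ?thesis
    unfolding chi_squared_def by (intro real_distribution_distr) measurable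
qed

section \<open>Likelihood ratios of nested models\<close>

lemma nested_chain:
  assumes "\<And>j. nested (M j) (M (Suc j))"
  shows "nested (M 0) (M j)"
proof (induction j)
  case 0
  show ?case by (auto simp: nested_def)
next
  case (Suc j)
  then show ?case using assms[of j] unfolding nested_def by metis
qed

text \<open>The larger model reproduces the density at the maximizer of the smaller one, and its own
  maximum dominates that value.\<close>

lemma max_lik_mono:
  assumes "nested M M'" "n \<ge> 1" "y \<in> space (data_space n)"
    and "is_mle M n y (est n y)" "is_mle M' n y (est' n y)"
  shows "max_lik M est n y \<le> max_lik M' est' n y"
  using assms unfolding nested_def is_mle_def max_lik_def by metis

text \<open>Positivity splits the logarithm of the ratio into a difference; the penalty difference
  exponentiates to a power of \<open>n\<close>.\<close>

lemma exp_BIC_diff: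
  assumes "max_lik (M 0) (est 0) n y > 0" "max_lik (M j) (est j) n y > 0" "n \<ge> 1"
  shows "exp (BIC (M j) (est j) n y - BIC (M 0) (est 0) n y) =
    exp (log_lik_ratio M est j n y / 2) *
    real n powr (- ((real (nparams (M j)) - real (nparams (M 0))) / 2))"
proof -
  have "BIC (M j) (est j) n y - BIC (M 0) (est 0) n y = log_lik_ratio M est j n y / 2 +
      (- ((real (nparams (M j)) - real (nparams (M 0))) / 2)) * ln (real n)"
    using assms by (simp add: BIC_def log_lik_ratio_def ln_div field_simps)
  moreover have "real n powr (- ((real (nparams (M j)) - real (nparams (M 0))) / 2)) =
      exp ((- ((real (nparams (M j)) - real (nparams (M 0))) / 2)) * ln (real n))"
    using assms by (simp add: powr_def)
  ultimately show ?thesis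
    by (simp only: exp_add)
qed

text \<open>Data drawn from a density almost surely fall where that density is positive, and the
  maximum over the model is at least as large there.\<close>

lemma AE_max_lik_pos:
  assumes "dens M n \<theta> \<in> borel_measurable (\<nu> n)" "\<theta> \<in> params M"
    and "AE y in data_distr \<nu> M \<theta> n. is_mle M n y (est n y)"
  shows "AE y in data_distr \<nu> M \<theta> n. max_lik M est n y > 0"
proof -
  have "AE y in data_distr \<nu> M \<theta> n. dens M n \<theta> y > 0"
    using assms(1) unfolding data_distr_def by (subst AE_density) auto
  with assms(3) show ?thesis
    by eventually_elim (use assms(2) in \<open>force simp: is_mle_def max_lik_def\<close>)
qed

text \<open>
  With \<open>S\<close> the sum and \<open>R\<close> the contribution of the indices \<open>j \<ge> 2\<close> to \<open>x powr ((m 1 - m 0) / 2) * S\<close>,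
  the difference is \<open>(R - q 1 * S) / (1 + S)\<close>.
\<close>

lemma scaled_posterior_bound:
  fixes q m :: "nat \<Rightarrow> real" and x c :: real
  assumes "x > 0" "k \<ge> 1" and q: "\<And>j. j \<in> {1..k} \<Longrightarrow> 0 \<le> q j \<and> q j \<le> c"
  shows "\<bar>x powr ((m 1 - m 0) / 2) *
      (1 - inverse (1 + (\<Sum>j=1..k. q j * x powr (- ((m j - m 0) / 2))))) - q 1\<bar>
    \<le> c * (\<Sum>j=2..k. x powr (- ((m j - m 1) / 2))) +
      c\<^sup>2 * (\<Sum>j=1..k. x powr (- ((m j - m 0) / 2)))"
proof -
  define a where "a = x powr ((m 1 - m 0) / 2)"
  define S where "S = (\<Sum>j=1..k. q j * x powr (- ((m j - m 0) / 2)))"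
  define R where "R = (\<Sum>j=2..k. q j * x powr (- ((m j - m 1) / 2)))"
  have "0 \<le> S" "0 \<le> R"
    using q by (auto simp: S_def R_def intro!: sum_nonneg)
  \<comment> \<open>The factor \<open>a\<close> shifts the reference exponent from
    \<open>m 0\<close> to \<open>m 1\<close>; the term for index 1 thereby loses its power of
    \<open>x\<close> and becomes \<open>q 1\<close>.\<close>
  have aw: "a * x powr (- ((m j - m 0) / 2)) = x powr (- ((m j - m 1) / 2))" for j
  proof -
    have "(m 1 - m 0) / 2 + - ((m j - m 0) / 2) = - ((m j - m 1) / 2)"
      by (simp add: field_simps)
    then show ?thesis
      unfolding a_def powr_add[symmetric] by simp
  qed
  have "a * S = (\<Sum>j=1..k. q j * x powr (- ((m j - m 1) / 2)))"
    unfolding S_def sum_distrib_left by (intro sum.cong) (simp_all only: aw[symmetric] mult_ac)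
  also have "\<dots> = q 1 + R"
    using \<open>k \<ge> 1\<close> \<open>x > 0\<close> by (simp add: R_def sum.atLeast_Suc_atMost numeral_2_eq_2)
  finally have aS: "a * S = q 1 + R" .
  have "a * (1 - inverse (1 + S)) - q 1 = (a * S - q 1 * (1 + S)) / (1 + S)"
    using \<open>0 \<le> S\<close> by (simp add: field_simps)
  also have "\<dots> = (R - q 1 * S) / (1 + S)"
    unfolding aS by (simp add: algebra_simps)
  finally have "\<bar>a * (1 - inverse (1 + S)) - q 1\<bar> = \<bar>R - q 1 * S\<bar> / (1 + S)"
    using \<open>0 \<le> S\<close> by simp
  \<comment> \<open>The denominator is at least 1. Since \<open>R\<close> and \<open>q 1 * S\<close>
    are nonnegative, the difference is then bounded by their sum.\<close>
  also have "\<dots> \<le> \<bar>R - q 1 * S\<bar>"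
    using \<open>0 \<le> S\<close> by (simp add: divide_le_eq mult_left_mono algebra_simps)
  also have "\<dots> \<le> R + q 1 * S"
    using \<open>0 \<le> S\<close> \<open>0 \<le> R\<close> q[of 1] \<open>k \<ge> 1\<close> by (simp add: abs_le_iff)
  also have "\<dots> \<le> c * (\<Sum>j=2..k. x powr (- ((m j - m 1) / 2))) +
      c * (c * (\<Sum>j=1..k. x powr (- ((m j - m 0) / 2))))"
  proof (intro add_mono mult_mono)
    show "R \<le> c * (\<Sum>j=2..k. x powr (- ((m j - m 1) / 2)))"
      unfolding R_def sum_distrib_left using q by (intro sum_mono mult_right_mono) auto
    show "S \<le> c * (\<Sum>j=1..k. x powr (- ((m j - m 0) / 2)))"
      unfolding S_def sum_distrib_left using q by (intro sum_mono mult_right_mono) auto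
  qed (use q[of 1] \<open>k \<ge> 1\<close> \<open>0 \<le> S\<close> in auto)
  finally show ?thesis
    by (simp add: a_def S_def power2_eq_square mult.assoc)
qed

text \<open>For fixed \<open>k\<close> both sums are finite and every exponent is strictly negative:
  the first sum starts at 2, past the index 1 whose exponent would be 0.\<close>

lemma scaled_posterior_bound_tendsto_0:
  fixes m :: "nat \<Rightarrow> real"
  assumes "strict_mono m"
  shows "(\<lambda>n. c * (\<Sum>j=2..k. real n powr (- ((m j - m 1) / 2))) +
      c\<^sup>2 * (\<Sum>j=1..k. real n powr (- ((m j - m 0) / 2)))) \<longlonglongrightarrow> 0"
proof -
  have "(\<lambda>n. real n powr (- ((m j - m i) / 2))) \<longlonglongrightarrow> 0" if "i < j" for i j
    using strict_monoD[OF assms that]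
    by (intro tendsto_neg_powr filterlim_real_sequentially) simp
  then have "(\<lambda>n. c * (\<Sum>j=2..k. real n powr (- ((m j - m 1) / 2))) +
      c\<^sup>2 * (\<Sum>j=1..k. real n powr (- ((m j - m 0) / 2)))) \<longlonglongrightarrow>
      c * (\<Sum>j=2..k. 0) + c\<^sup>2 * (\<Sum>j=1..k. 0)"
    by (intro tendsto_intros) auto
  then show ?thesis by simp
qed

section \<open>Limit law of the scaled statistic\<close>

theorem theorem2:
  fixes \<nu> :: "nat \<Rightarrow> (nat \<Rightarrow> real) measure"
    and M :: "nat \<Rightarrow> model"
    and est :: "nat \<Rightarrow> nat \<Rightarrow> (nat \<Rightarrow> real) \<Rightarrow> (nat \<Rightarrow> real)"
    and \<theta>\<^sub>0 :: "nat \<Rightarrow> real"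
    and P :: "nat \<Rightarrow> (nat \<Rightarrow> real) measure"
  assumes "\<And>n. sets (\<nu> n) = sets (data_space n)"
    and "\<And>j. statistical_model \<nu> (M j)"
    and "\<And>j. nested (M j) (M (Suc j))"
    and "strict_mono (\<lambda>j. nparams (M j))"
    and "\<theta>\<^sub>0 \<in> params (M 0)"
    and "P = data_distr \<nu> (M 0) \<theta>\<^sub>0"
    and "\<And>j. \<forall>\<^sub>F n in sequentially. AE y in P n. is_mle (M j) n y (est j n y)"
    and "\<And>j. \<forall>\<^sub>F n in sequentially. max_lik (M j) (est j) n \<in> borel_measurable (data_space n)"
    and "converges_in_distribution P (log_lik_ratio M est 1)
           (chi_squared (nparams (M 1) - nparams (M 0)))"
    and "\<And>j. j \<ge> 2 \<Longrightarrow> bounded_in_probability P (log_lik_ratio M est j)"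
  shows "\<exists>K :: nat \<Rightarrow> nat. filterlim K at_top sequentially \<and>
    converges_in_distribution P
      (\<lambda>n y. real n powr (real (nparams (M 1) - nparams (M 0)) / 2) *
        (1 - inverse (1 + (\<Sum>j=1..K n. exp (BIC (M j) (est j) n y - BIC (M 0) (est 0) n y)))))
      (distr (chi_squared (nparams (M 1) - nparams (M 0))) borel (\<lambda>x. exp (x / 2)))"
proof -
  note sets_nu = assms(1) and sm = assms(2) and mono = assms(4) and P_def = assms(6)
  define m where "m j = real (nparams (M j))" for j
  define \<mu> where "\<mu> = chi_squared (nparams (M 1) - nparams (M 0))"
  define L where "L = log_lik_ratio M est"
  \<comment> \<open>The number of models is a separate argument: it is first held fixed and later
    replaced by \<open>K n\<close>.\<close>
  define Y where "Y k n y = real n powr (real (nparams (M 1) - nparams (M 0)) / 2) *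
      (1 - inverse (1 + (\<Sum>j=1..k. exp (BIC (M j) (est j) n y - BIC (M 0) (est 0) n y))))"
    for k n y
  have \<mu>: "real_distribution \<mu>"
    unfolding \<mu>_def by (rule real_distribution_chi_squared)
  have m: "strict_mono m"
    using mono by (auto simp: m_def strict_mono_def)
  \<comment> \<open>Parameter counts increase, so the subtraction on naturals does not
    truncate.\<close>
  have m10: "real (nparams (M 1) - nparams (M 0)) = m 1 - m 0"
    using strict_monoD[OF m, of 0 1] by (simp add: m_def)
  have sets_P: "sets (P n) = sets (data_space n)" for n
    by (simp add: P_def data_distr_def sets_nu)
  have space_P: "space (P n) = space (data_space n)" for n
    by (rule sets_eq_imp_space_eq[OF sets_P])
  have P: "\<forall>\<^sub>F n in sequentially. prob_space (P n)"
    using eventually_ge_at_top[of 1]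
    by eventually_elim (use sm assms(5) in \<open>simp add: statistical_model_def P_def\<close>)
  have meas: "\<forall>\<^sub>F n in sequentially. max_lik (M j) (est j) n \<in> borel_measurable (P n)" for j
    using assms(8)[of j] by eventually_elim (simp add: measurable_cong_sets[OF sets_P refl])
  have measL: "\<forall>\<^sub>F n in sequentially. L j n \<in> borel_measurable (P n)" for j
    using meas[of j] meas[of 0]
    unfolding L_def log_lik_ratio_def[abs_def] by eventually_elim measurable
  have measY: "\<forall>\<^sub>F n in sequentially. Y k n \<in> borel_measurable (P n)" for k
  proof -
    have "\<forall>\<^sub>F n in sequentially. \<forall>j\<in>{0..k}. max_lik (M j) (est j) n \<in> borel_measurable (P n)"
      using meas by (subst eventually_ball_finite_distrib) auto
    then show ?thesis
    proof eventually_elim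
      case (elim n)
      have "(\<lambda>y. exp (BIC (M j) (est j) n y - BIC (M 0) (est 0) n y))
          \<in> borel_measurable (P n)" if "j \<in> {1..k}" for j
      proof -
        have [measurable]: "max_lik (M j) (est j) n \<in> borel_measurable (P n)"
          "max_lik (M 0) (est 0) n \<in> borel_measurable (P n)"
          using elim that by auto
        show ?thesis unfolding BIC_def by measurable
      qed
      then show ?case
        unfolding Y_def[abs_def] by measurable
    qed
  qed
  have X: "converges_in_distribution P (\<lambda>n y. exp (L 1 n y / 2)) (distr \<mu> borel (\<lambda>x. exp (x / 2)))"
    using assms(9) unfolding L_def \<mu>_def
    by (intro converges_in_distribution_continuous_map[OF P] real_distribution_chi_squared) auto
  have bdL: "bounded_in_probability P (L j)" if "j \<ge> 1" for j
  proof (cases "j = 1")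
    case True
    then show ?thesis
      using converges_in_distribution_imp_bounded[OF P assms(9) real_distribution_chi_squared]
      by (simp add: L_def)
  next
    case False
    then show ?thesis
      using assms(10)[of j] that by (simp add: L_def)
  qed
  \<comment> \<open>The maximum of the null model is almost surely positive under the null law, and
    nesting passes this on to every \<open>M j\<close>. This is what \<open>exp_BIC_diff\<close>
    requires.\<close>
  have pos: "\<forall>\<^sub>F n in sequentially. AE y in P n. max_lik (M j) (est j) n y > 0" for j
    using assms(7)[of 0] assms(7)[of j] eventually_ge_at_top[of 1]
  proof eventually_elim
    case (elim n)
    have "dens (M 0) n \<theta>\<^sub>0 \<in> borel_measurable (\<nu> n)"
      using sm[of 0] assms(5) \<open>1 \<le> n\<close>
      by (simp add: statistical_model_def measurable_cong_sets[OF sets_nu refl])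
    then have "AE y in P n. max_lik (M 0) (est 0) n y > 0"
      using elim(1) assms(5) unfolding P_def by (intro AE_max_lik_pos)
    with elim(1,2) AE_space show ?case
    proof eventually_elim
      case (elim y)
      have "max_lik (M 0) (est 0) n y \<le> max_lik (M j) (est j) n y"
        using elim(1-3) \<open>1 \<le> n\<close> space_P
        by (intro max_lik_mono[OF nested_chain] assms(3)) auto
      with elim(4) show ?case by simp
    qed
  qed
  \<comment> \<open>Closeness in probability to the first likelihood ratio for each fixed
    \<open>k\<close>: a random event of small probability is excluded, and elsewhere a deterministic
    bound applies.\<close>
  have close: "\<forall>\<^sub>F n in sequentially.
      measure (P n) {y \<in> space (P n). \<bar>Y k n y - exp (L 1 n y / 2)\<bar> > \<epsilon>} < \<epsilon>"
    if "\<epsilon> > 0" "k \<ge> 1" for k \<epsilon>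
  proof -
    have "\<exists>C. \<forall>\<^sub>F n in sequentially.
        measure (P n) {y \<in> space (P n). \<exists>j\<in>{1..k}. \<bar>L j n y\<bar> > C} < \<epsilon>"
      by (rule bounded_in_probability_finite_family[OF P])
        (use measL bdL \<open>\<epsilon> > 0\<close> in auto)
    then obtain C where C: "\<forall>\<^sub>F n in sequentially.
        measure (P n) {y \<in> space (P n). \<exists>j\<in>{1..k}. \<bar>L j n y\<bar> > C} < \<epsilon>" ..
    \<comment> \<open>If \<open>\<bar>L j n y\<bar> \<le> C\<close>, then the likelihood ratio
      \<open>exp (L j n y / 2)\<close> is at most \<open>c\<close>.\<close>
    define c where "c = exp (C / 2)"
    define b where "b n = c * (\<Sum>j=2..k. real n powr (- ((m j - m 1) / 2))) +
        c\<^sup>2 * (\<Sum>j=1..k. real n powr (- ((m j - m 0) / 2)))" for n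
    have "\<forall>\<^sub>F n in sequentially. b n < \<epsilon>"
      using scaled_posterior_bound_tendsto_0[OF m] \<open>\<epsilon> > 0\<close>
      unfolding b_def by (rule order_tendstoD)
    moreover have "\<forall>\<^sub>F n in sequentially. \<forall>j\<in>{0..k}.
        (AE y in P n. max_lik (M j) (est j) n y > 0) \<and> L j n \<in> borel_measurable (P n)"
      using pos measL by (subst eventually_ball_finite_distrib) (auto intro: eventually_conj)
    ultimately show ?thesis
      using P C measY[of k] eventually_ge_at_top[of 1]
    proof eventually_elim
      case (elim n)
      interpret prob_space "P n" by (rule elim)
      let ?A = "{y \<in> space (P n). \<exists>j\<in>{1..k}. \<bar>L j n y\<bar> > C}"
      have A: "?A \<in> sets (P n)"
      proof (rule sets.sets_Collect_finite_Ex)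
        fix j assume "j \<in> {1..k}"
        then have [measurable]: "L j n \<in> borel_measurable (P n)"
          using elim(2) by simp
        show "{y \<in> space (P n). \<bar>L j n y\<bar> > C} \<in> sets (P n)"
          by measurable
      qed simp
      have "AE y in P n. \<forall>j\<in>{0..k}. max_lik (M j) (est j) n y > 0"
        using elim(2) by (intro AE_finite_allI) auto
      \<comment> \<open>Where all likelihoods are positive, a deviation above \<epsilon> exceeds
        \<open>b n\<close> and so forces some \<open>\<bar>L j n y\<bar> > C\<close>. The inclusion
        holds only almost everywhere, which suffices to compare probabilities.\<close>
      then have "AE y in P n.
          y \<in> {y \<in> space (P n). \<bar>Y k n y - exp (L 1 n y / 2)\<bar> > \<epsilon>} \<longrightarrow> y \<in> ?A"
      proof eventually_elim
        case pos_y: (elim y)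
        have "\<bar>Y k n y - exp (L 1 n y / 2)\<bar> \<le> b n" if "\<forall>j\<in>{1..k}. \<bar>L j n y\<bar> \<le> C"
        proof -
          have "(\<Sum>j=1..k. exp (BIC (M j) (est j) n y - BIC (M 0) (est 0) n y)) =
              (\<Sum>j=1..k. exp (L j n y / 2) * real n powr (- ((m j - m 0) / 2)))"
            unfolding L_def m_def using pos_y \<open>1 \<le> n\<close>
            by (intro sum.cong refl exp_BIC_diff) auto
          moreover have "0 \<le> exp (L j n y / 2) \<and> exp (L j n y / 2) \<le> c" if "j \<in> {1..k}" for j
            using that \<open>\<forall>j\<in>{1..k}. \<bar>L j n y\<bar> \<le> C\<close> by (force simp: c_def)
          ultimately show ?thesis
            using scaled_posterior_bound[of "real n" k "\<lambda>j. exp (L j n y / 2)" c m]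
              \<open>k \<ge> 1\<close> \<open>1 \<le> n\<close>
            unfolding Y_def b_def m10 by simp
        qed
        with elim(1) show ?case by force
      qed
      then have "measure (P n) {y \<in> space (P n). \<bar>Y k n y - exp (L 1 n y / 2)\<bar> > \<epsilon>}
          \<le> measure (P n) ?A"
        using A by (rule finite_measure_mono_AE)
      with elim(4) show ?case by simp
    qed
  qed
  \<comment> \<open>The tolerance \<open>1 / real k\<close> shrinks along \<open>K n\<close>. The
    guard is for \<open>k = 0\<close>, where \<open>1 / real k\<close> is 0 and no measure lies
    below it. Measurability is included because \<open>measY\<close> treats only fixed
    \<open>k\<close>.\<close>
  define Q where "Q k n \<longleftrightarrow> k \<ge> 1 \<longrightarrow> Y k n \<in> borel_measurable (P n) \<and>
      measure (P n) {y \<in> space (P n). \<bar>Y k n y - exp (L 1 n y / 2)\<bar> > 1 / real k} < 1 / real k"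
    for k n
  have "\<forall>\<^sub>F n in sequentially. Q k n" for k
    unfolding Q_def using measY[of k] close[of "1 / real k" k]
    by (cases "k \<ge> 1") (auto intro: eventually_conj)
  then obtain K where K: "filterlim K at_top sequentially"
    and QK: "\<forall>\<^sub>F n in sequentially. Q (K n) n"
    using eventually_diagonal[of Q] by blast
  have K_ge: "\<forall>\<^sub>F n in sequentially. K n \<ge> k" for k
    using K by (simp add: filterlim_at_top)
  have "converges_in_distribution P (\<lambda>n. Y (K n) n) (distr \<mu> borel (\<lambda>x. exp (x / 2)))"
  proof (rule converges_in_distribution_close[OF P X])
    show "real_distribution (distr \<mu> borel (\<lambda>x. exp (x / 2)))"
    proof -
      interpret real_distribution \<mu> by (rule \<mu>)
      show ?thesis by simp
    qed
    show "\<forall>\<^sub>F n in sequentially. Y (K n) n \<in> borel_measurable (P n)"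
      using QK K_ge[of 1] by eventually_elim (simp add: Q_def)
    fix \<epsilon> :: real assume "\<epsilon> > 0"
    then obtain k where k: "k > 0" "1 / real k < \<epsilon>"
      using reals_Archimedean[of \<epsilon>] by (metis inverse_eq_divide zero_less_Suc)
    show "\<forall>\<^sub>F n in sequentially.
        measure (P n) {y \<in> space (P n). \<bar>Y (K n) n y - exp (L 1 n y / 2)\<bar> > \<epsilon>} < \<epsilon>"
      using QK K_ge[of k] P measL[of 1]
    proof eventually_elim
      case (elim n)
      interpret prob_space "P n" by (rule elim)
      have le: "1 / real (K n) < \<epsilon>"
        using k elim(2) by (smt (verit) frac_le of_nat_0_less_iff of_nat_le_iff)
      have QK': "Y (K n) n \<in> borel_measurable (P n)"
        "measure (P n) {y \<in> space (P n). \<bar>Y (K n) n y - exp (L 1 n y / 2)\<bar> > 1 / real (K n)}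
          < 1 / real (K n)"
        using elim(1,2) k(1) by (auto simp: Q_def)
      note [measurable] = QK'(1) elim(4)
      \<comment> \<open>Since \<open>1 / real (K n) < \<epsilon>\<close>, the event with threshold
        \<epsilon> lies in the one controlled by \<open>Q\<close>, whose probability is below
        \<open>1 / real (K n)\<close>.\<close>
      have "measure (P n) {y \<in> space (P n). \<bar>Y (K n) n y - exp (L 1 n y / 2)\<bar> > \<epsilon>}
          \<le> measure (P n) {y \<in> space (P n). \<bar>Y (K n) n y - exp (L 1 n y / 2)\<bar> > 1 / real (K n)}"
      proof (rule finite_measure_mono)
        show "{y \<in> space (P n). \<bar>Y (K n) n y - exp (L 1 n y / 2)\<bar> > 1 / real (K n)} \<in> sets (P n)"
          by measurable
      qed (use le in auto)
      with QK'(2) le show ?case by linarith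
    qed
  qed
  with K show ?thesis
    unfolding Y_def \<mu>_def by blast
qed

end
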